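(* Let $T\ge 1$, $K\in\{0,1,\dots,T-1\}$, and let $c(t)\ge 0$ for $t=1,\dots,T$ be transaction cost rates. Let $(\mathbf w_j(t))_{0\le t\le T}$, $j\in\mathcal N$, be expert portfolios in $\mathcal W$ with $\mathbf w_j(0)=\mathbf w_0$ for all $j$, let $\mathbf y(1),\dots,\mathbf y(T)\in\mathcal Y$, and let $\mathbf q(1),\dots,\mathbf q(T)\in\Delta_n$ be aggregation weights generated by any algorithm, with the convention $\mathbf q(0):=\mathbf q(1)$. Then for any minimizing benchmark sequence $(j_1,\dots,j_T)\in\mathcal J_{T,K}$, i.e. any sequence attaining $\min_{\mathbf j\in\mathcal J_{T,K}}\sum_{t=1}^T\tilde\ell_{j_t}(t)$, the cost-sensitive tracking regret satisfies $$R^c_{\rm track}(T,K)\le \sum_{t=1}^T\left[\left(\sum_{j\in\mathcal N}q_j(t)\tilde\ell_j(t)\right)-\tilde\ell_{j_t}(t)\right]+\sum_{t=1}^T c(t)\,\|\mathbf q(t)-\mathbf q(t-1)\|_1 .$$ Moreover, the coefficient $1$ of the last sum is sharp: it cannot be reduced uniformly over all admissible expert portfolios and aggregation rules. That is, for every real $\kappa<1$ there exist a horizon $T\ge1$, a switching budget $K\in\{0,1,\dots,T-1\}$, a number of assets $m\ge2$, an initial portfolio $\mathbf w_0\in\mathcal W$, a finite set $\mathcal N$ of $n\ge2$ experts, an outcome set $\mathcal Y\subseteq\mathbb R^m$, a loss function $\ell:\mathcal W\times\mathcal Y\to\mathbb R$ convex in its first argument and with values in $[a,b]$ for some real $a<b$,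 cost rates $c(t)\ge0$, outcomes $\mathbf y(t)\in\mathcal Y$, expert portfolios $\mathbf w_j(t)\in\mathcal W$ with $\mathbf w_j(0)=\mathbf w_0$, aggregation weights $\mathbf q(t)\in\Delta_n$ with $\mathbf q(0):=\mathbf q(1)$, and a minimizing benchmark sequence $(j_1,\dots,j_T)\in\mathcal J_{T,K}$, for which $$R^c_{\rm track}(T,K)> \sum_{t=1}^T\left[\left(\sum_{j\in\mathcal N}q_j(t)\tilde\ell_j(t)\right)-\tilde\ell_{j_t}(t)\right]+\kappa\sum_{t=1}^T c(t)\,\|\mathbf q(t)-\mathbf q(t-1)\|_1 .$$
   Context: Let $m\ge2$ (number of assets), $\mathcal W:=\{\mathbf w\in\mathbb R_+^m:\mathbf w^\top\mathbf 1=1\}$, and $\mathcal Y\subseteq\mathbb R^m$. Let $\mathcal N$ be a finite set of $n\ge2$ experts and $\Delta_n:=\{\mathbf q\in\mathbb R_+^n:\sum_{j\in\mathcal N}q_j=1\}$. The loss $\ell:\mathcal W\times\mathcal Y\to\mathbb R$ is convex in its first argument and satisfies $a\le\ell(\mathbf w,\mathbf y)\le b$ for all $(\mathbf w,\mathbf y)$, where $a<b$ are fixed real constants. A prescribed initial portfolio $\mathbf w_0\in\mathcal W$ is given. The aggregate portfolio is $\widehat{\mathbf w}(t):=\sum_{j\in\mathcal N}q_j(t)\mathbf w_j(t)$ for $t\ge1$, with $\widehat{\mathbf w}(0):=\mathbf w_0$. The cost-sensitive loss of expert $j$ at time $t\ge 1$ is $\tilde\ell_j(t):=\ell(\mathbf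 w_j(t),\mathbf y(t))+c(t)\|\mathbf w_j(t)-\mathbf w_j(t-1)\|_1$. For $\mathbf j=(j_1,\dots,j_T)\in\mathcal N^T$, the number of switches is $S_T(\mathbf j):=\#\{t\in\{1,\dots,T-1\}:j_t\ne j_{t+1}\}$, and $\mathcal J_{T,K}:=\{\mathbf j\in\mathcal N^T:S_T(\mathbf j)\le K\}$. The cost-sensitive tracking regret is $$R^c_{\rm track}(T,K):=\sum_{t=1}^T\left[\ell(\widehat{\mathbf w}(t),\mathbf y(t))+c(t)\|\widehat{\mathbf w}(t)-\widehat{\mathbf w}(t-1)\|_1\right]-\min_{\mathbf j\in\mathcal J_{T,K}}\sum_{t=1}^T\tilde\ell_{j_t}(t).$$ *)

theory Defs
  imports Complex_Main "HOL-Library.FuncSet" "Jordan_Normal_Form.Matrix"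
begin

text \<open>
  The number of assets is quantified inside the statement, so \<open>\<real>\<^sup>m\<close> is the set
  \<^term>\<open>carrier_vec m :: real vec set\<close>. Experts are elements of a finite set \<open>N\<close>.
  Expert-indexed weights are functions of which only the values on \<open>N\<close> are ever used, and
  time-indexed families are functions on \<^typ>\<open>nat\<close> of which only the values at
  times up to \<open>T\<close> are ever used.
\<close>

definition portfolios :: "nat \<Rightarrow> real vec set" where
  "portfolios m = {w \<in> carrier_vec m. (\<forall>i<m. 0 \<le> w $ i) \<and> (\<Sum>i<m. w $ i) = 1}"

definition weights :: "'e set \<Rightarrow> ('e \<Rightarrow> real) set" where
  "weights N = {q. (\<forall>j\<in>N. 0 \<le> q j) \<and> (\<Sum>j\<in>N. q j) = 1}"

definition l1_norm_vec :: "real vec \<Rightarrow> real" where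
  "l1_norm_vec v = (\<Sum>i<dim_vec v. \<bar>v $ i\<bar>)"

definition l1_dist_on :: "'e set \<Rightarrow> ('e \<Rightarrow> real) \<Rightarrow> ('e \<Rightarrow> real) \<Rightarrow> real" where
  "l1_dist_on N p q = (\<Sum>j\<in>N. \<bar>p j - q j\<bar>)"

text \<open>
  The inequality is that of \<open>convex_on\<close> in HOL-Analysis, which does not apply because
  \<^typ>\<open>real vec\<close> is not an instance of \<^class>\<open>real_vector\<close>.
\<close>

definition convex_on_portfolios :: "nat \<Rightarrow> (real vec \<Rightarrow> real) \<Rightarrow> bool" where
  "convex_on_portfolios m f \<longleftrightarrow>
     (\<forall>u\<in>portfolios m. \<forall>v\<in>portfolios m. \<forall>r\<ge>0. \<forall>s\<ge>0. r + s = 1 \<longrightarrow>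
        f (r \<cdot>\<^sub>v u + s \<cdot>\<^sub>v v) \<le> r * f u + s * f v)"

definition loss_function ::
  "nat \<Rightarrow> real vec set \<Rightarrow> real \<Rightarrow> real \<Rightarrow> (real vec \<Rightarrow> real vec \<Rightarrow> real) \<Rightarrow> bool" where
  "loss_function m Y a b l \<longleftrightarrow>
     (\<forall>y\<in>Y. convex_on_portfolios m (\<lambda>w. l w y)) \<and>
     (\<forall>w\<in>portfolios m. \<forall>y\<in>Y. a \<le> l w y \<and> l w y \<le> b)"

definition aggregate ::
  "nat \<Rightarrow> 'e set \<Rightarrow> real vec \<Rightarrow> ('e \<Rightarrow> nat \<Rightarrow> real vec) \<Rightarrow> (nat \<Rightarrow> 'e \<Rightarrow> real) \<Rightarrow> nat \<Rightarrow> real vec" where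
  "aggregate m N w0 w q t =
     (if t = 0 then w0 else vec m (\<lambda>i. \<Sum>j\<in>N. q t j * w j t $ i))"

definition cost_loss ::
  "(real vec \<Rightarrow> real vec \<Rightarrow> real) \<Rightarrow> (nat \<Rightarrow> real) \<Rightarrow> (nat \<Rightarrow> real vec) \<Rightarrow> (nat \<Rightarrow> real vec) \<Rightarrow> nat \<Rightarrow> real" where
  "cost_loss l c y x t = l (x t) (y t) + c t * l1_norm_vec (x t - x (t - 1))"

definition switches :: "nat \<Rightarrow> (nat \<Rightarrow> 'e) \<Rightarrow> nat" where
  "switches T js = card {t \<in> {1..T - 1}. js t \<noteq> js (t + 1)}"

text \<open>Extensionality outside \<open>{1..T}\<close> makes this the finite set of tuples of length \<open>T\<close>.\<close>

definition benchmark_seqs :: "'e set \<Rightarrow> nat \<Rightarrow> nat \<Rightarrow> (nat \<Rightarrow> 'e) set" where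
  "benchmark_seqs N T K = {js \<in> {1..T} \<rightarrow>\<^sub>E N. switches T js \<le> K}"

definition seq_loss ::
  "(real vec \<Rightarrow> real vec \<Rightarrow> real) \<Rightarrow> (nat \<Rightarrow> real) \<Rightarrow> (nat \<Rightarrow> real vec) \<Rightarrow> ('e \<Rightarrow> nat \<Rightarrow> real vec) \<Rightarrow>
   nat \<Rightarrow> (nat \<Rightarrow> 'e) \<Rightarrow> real" where
  "seq_loss l c y w T js = (\<Sum>t=1..T. cost_loss l c y (w (js t)) t)"

definition min_benchmark_loss ::
  "'e set \<Rightarrow> (real vec \<Rightarrow> real vec \<Rightarrow> real) \<Rightarrow> (nat \<Rightarrow> real) \<Rightarrow> (nat \<Rightarrow> real vec) \<Rightarrow>
   ('e \<Rightarrow> nat \<Rightarrow> real vec) \<Rightarrow> nat \<Rightarrow> nat \<Rightarrow> real" where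
  "min_benchmark_loss N l c y w T K = Min (seq_loss l c y w T ` benchmark_seqs N T K)"

definition minimizing_benchmark ::
  "'e set \<Rightarrow> (real vec \<Rightarrow> real vec \<Rightarrow> real) \<Rightarrow> (nat \<Rightarrow> real) \<Rightarrow> (nat \<Rightarrow> real vec) \<Rightarrow>
   ('e \<Rightarrow> nat \<Rightarrow> real vec) \<Rightarrow> nat \<Rightarrow> nat \<Rightarrow> (nat \<Rightarrow> 'e) \<Rightarrow> bool" where
  "minimizing_benchmark N l c y w T K js \<longleftrightarrow>
     js \<in> benchmark_seqs N T K \<and> seq_loss l c y w T js = min_benchmark_loss N l c y w T K"

definition tracking_regret ::
  "nat \<Rightarrow> 'e set \<Rightarrow> (real vec \<Rightarrow> real vec \<Rightarrow> real) \<Rightarrow> (nat \<Rightarrow> real) \<Rightarrow> (nat \<Rightarrow> real vec) \<Rightarrow> real vec \<Rightarrow>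
   ('e \<Rightarrow> nat \<Rightarrow> real vec) \<Rightarrow> (nat \<Rightarrow> 'e \<Rightarrow> real) \<Rightarrow> nat \<Rightarrow> nat \<Rightarrow> real" where
  "tracking_regret m N l c y w0 w q T K =
     (\<Sum>t=1..T. cost_loss l c y (aggregate m N w0 w q) t) - min_benchmark_loss N l c y w T K"

definition tracking_setting ::
  "nat \<Rightarrow> real vec set \<Rightarrow> 'e set \<Rightarrow> real \<Rightarrow> real \<Rightarrow> (real vec \<Rightarrow> real vec \<Rightarrow> real) \<Rightarrow>
   (nat \<Rightarrow> real) \<Rightarrow> (nat \<Rightarrow> real vec) \<Rightarrow> real vec \<Rightarrow> ('e \<Rightarrow> nat \<Rightarrow> real vec) \<Rightarrow> (nat \<Rightarrow> 'e \<Rightarrow> real) \<Rightarrow>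
   nat \<Rightarrow> nat \<Rightarrow> bool" where
  "tracking_setting m Y N a b l c y w0 w q T K \<longleftrightarrow>
     2 \<le> m \<and> Y \<subseteq> carrier_vec m \<and>
     finite N \<and> 2 \<le> card N \<and>
     a < b \<and> loss_function m Y a b l \<and>
     1 \<le> T \<and> K \<le> T - 1 \<and>
     (\<forall>t\<in>{1..T}. 0 \<le> c t) \<and>
     (\<forall>t\<in>{1..T}. y t \<in> Y) \<and>
     w0 \<in> portfolios m \<and>
     (\<forall>j\<in>N. w j 0 = w0 \<and> (\<forall>t\<in>{0..T}. w j t \<in> portfolios m)) \<and>
     (\<forall>t\<in>{1..T}. q t \<in> weights N) \<and> q 0 = q 1"

end

theory Submission
  imports Defs
begin

text \<open>
  The aggregate portfolio moves for two reasons: each expert moves, and the weights move.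
  Writing \<open>\<Delta>x(t) = x(t) - x(t - 1)\<close>, summation by parts at a single time step gives
  \[ \Delta \hat w(t) = \sum_j q_j(t) \, \Delta w_j(t) + \sum_j \Delta q_j(t) \, w_j(t-1). \]
  The first sum has norm at most the weighted average of the experts' own movements, and the
  second has norm at most \<open>\<parallel>\<Delta>q(t)\<parallel>\<^sub>1\<close>, because every portfolio has norm one
  (\<open>l1_norm_mixture_diff_le\<close>). Together with Jensen's inequality for the loss
  (\<open>mixture_jensen\<close>) this bounds the cost of the aggregate at each time by the weighted cost of
  the experts plus \<open>c(t) \<parallel>\<Delta>q(t)\<parallel>\<^sub>1\<close>. Subtracting the benchmark, which enters both
  sides through the same number, gives the bound on the regret.

  The decomposition shows how the bound can be attained: the experts stand still on portfolios with
  disjoint supports, and all the weight jumps from one to another. With two assets, two experts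
  each holding a single asset, a free first step to reach these positions and zero loss, every
  expert sequence costs nothing, while the aggregate pays exactly
  \<open>\<parallel>\<Delta>q(2)\<parallel>\<^sub>1 = 2\<close>.
\<close>

section \<open>Mixtures of portfolios\<close>

definition mixture :: "nat \<Rightarrow> 'e set \<Rightarrow> ('e \<Rightarrow> real) \<Rightarrow> ('e \<Rightarrow> real vec) \<Rightarrow> real vec" where
  "mixture m N p x = vec m (\<lambda>i. \<Sum>j\<in>N. p j * x j $ i)"

lemma portfoliosD:
  assumes "v \<in> portfolios m"
  shows "dim_vec v = m" "v \<in> carrier_vec m" "\<And>i. i < m \<Longrightarrow> 0 \<le> v $ i" "(\<Sum>i<m. v $ i) = 1"
  using assms by (auto simp: portfolios_def)

lemma mixture_in_portfolios:
  assumes "p \<in> weights N" and "\<And>j. j \<in> N \<Longrightarrow> x j \<in> portfolios m"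
  shows "mixture m N p x \<in> portfolios m"
proof -
  have "(\<Sum>i<m. \<Sum>j\<in>N. p j * x j $ i) = (\<Sum>j\<in>N. \<Sum>i<m. p j * x j $ i)"
    by (rule sum.swap)
  also have "\<dots> = (\<Sum>j\<in>N. p j * (\<Sum>i<m. x j $ i))"
    by (simp add: sum_distrib_left)
  also have "\<dots> = (\<Sum>j\<in>N. p j)"
    by (rule sum.cong) (simp_all add: portfoliosD(4)[OF assms(2)])
  also have "\<dots> = 1"
    using assms(1) by (simp add: weights_def)
  finally have "(\<Sum>i<m. \<Sum>j\<in>N. p j * x j $ i) = 1" .
  moreover have "0 \<le> (\<Sum>j\<in>N. p j * x j $ i)" if "i < m" for i
    using assms that by (auto intro!: sum_nonneg mult_nonneg_nonneg portfoliosD(3)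
        simp: weights_def)
  ultimately show ?thesis
    by (simp add: portfolios_def mixture_def)
qed

text \<open>
  Convexity speaks of two points only. For finitely many, one point is split off; the others are
  combined with their weights rescaled to sum to one, which is possible unless the split-off point
  carries all the weight.
\<close>

lemma mixture_jensen:
  assumes conv: "convex_on_portfolios m f"
    and "finite N" and "p \<in> weights N" and "\<And>j. j \<in> N \<Longrightarrow> x j \<in> portfolios m"
  shows "f (mixture m N p x) \<le> (\<Sum>j\<in>N. p j * f (x j))"
  using assms(2-)
proof (induction N arbitrary: p rule: finite_induct)
  case empty
  then show ?case by (simp add: weights_def)
next
  case (insert k F)
  define s where "s = (\<Sum>j\<in>F. p j)"
  have nonneg: "0 \<le> p j" if "j \<in> insert k F" for j
    using insert.prems(1) that by (auto simp: weights_def)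
  have total: "p k + s = 1"
    using insert by (simp add: weights_def s_def)
  have "0 \<le> s"
    unfolding s_def using nonneg by (intro sum_nonneg) auto
  have xk: "x k \<in> portfolios m"
    using insert.prems(2) by simp
  show ?case
  proof (cases "s = 0")
    case True
    then have zero: "p j = 0" if "j \<in> F" for j
      using sum_nonneg_eq_0_iff[OF insert.hyps(1), of p] nonneg that by (auto simp: s_def)
    have "mixture m (insert k F) p x = x k"
      using insert.hyps zero True total portfoliosD(1)[OF xk]
      by (intro eq_vecI) (auto simp: mixture_def)
    then show ?thesis
      using insert.hyps zero True total by simp
  next
    case False
    define r where "r = (\<lambda>j. p j / s)"
    have r: "r \<in> weights F"
      using False \<open>0 \<le> s\<close> nonneg
      by (auto simp: weights_def r_def s_def sum_divide_distrib[symmetric])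
    have u: "mixture m F r x \<in> portfolios m"
      using r insert.prems(2) by (intro mixture_in_portfolios) auto
    have rescale: "s * r j = p j" for j
      using False by (simp add: r_def)
    have "mixture m (insert k F) p x = p k \<cdot>\<^sub>v x k + s \<cdot>\<^sub>v mixture m F r x"
      using insert.hyps portfoliosD(1)[OF xk]
      by (intro eq_vecI)
        (auto simp: mixture_def sum_distrib_left mult.assoc[symmetric] rescale)
    also have "f \<dots> \<le> p k * f (x k) + s * f (mixture m F r x)"
      using conv xk u nonneg[of k] \<open>0 \<le> s\<close> total by (simp add: convex_on_portfolios_def)
    also have "\<dots> \<le> p k * f (x k) + s * (\<Sum>j\<in>F. r j * f (x j))"
      using insert.IH[OF r] insert.prems(2) \<open>0 \<le> s\<close> by (simp add: mult_left_mono)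
    also have "\<dots> = (\<Sum>j\<in>insert k F. p j * f (x j))"
      using insert.hyps by (simp add: sum_distrib_left mult.assoc[symmetric] rescale)
    finally show ?thesis .
  qed
qed

text \<open>
  Going from \<open>\<Sum>\<^sub>j p\<^sub>j x\<^sub>j\<close> to \<open>\<Sum>\<^sub>j r\<^sub>j z\<^sub>j\<close> by first changing
  the weights at the old points and then moving the points under the new weights separates the
  two sources of movement. In the change of weights each \<open>\<bar>r\<^sub>j - p\<^sub>j\<bar>\<close> is multiplied by the total mass of
  a portfolio, which is one.
\<close>

lemma l1_norm_mixture_diff_le:
  assumes r: "r \<in> weights N"
    and x: "\<And>j. j \<in> N \<Longrightarrow> x j \<in> portfolios m"
    and z: "\<And>j. j \<in> N \<Longrightarrow> z j \<in> portfolios m"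
  shows "l1_norm_vec (mixture m N r z - mixture m N p x)
    \<le> (\<Sum>j\<in>N. r j * l1_norm_vec (z j - x j)) + l1_dist_on N r p"
proof -
  have "\<bar>(\<Sum>j\<in>N. r j * z j $ i) - (\<Sum>j\<in>N. p j * x j $ i)\<bar>
      \<le> (\<Sum>j\<in>N. r j * \<bar>z j $ i - x j $ i\<bar> + \<bar>r j - p j\<bar> * x j $ i)" if "i < m" for i
  proof -
    have "(\<Sum>j\<in>N. r j * z j $ i) - (\<Sum>j\<in>N. p j * x j $ i)
        = (\<Sum>j\<in>N. r j * (z j $ i - x j $ i) + (r j - p j) * x j $ i)"
      by (simp add: sum_subtractf[symmetric] algebra_simps)
    also have "\<bar>\<dots>\<bar> \<le> (\<Sum>j\<in>N. \<bar>r j * (z j $ i - x j $ i) + (r j - p j) * x j $ i\<bar>)"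
      by (rule sum_abs)
    also have "\<dots> \<le> (\<Sum>j\<in>N. r j * \<bar>z j $ i - x j $ i\<bar> + \<bar>r j - p j\<bar> * x j $ i)"
    proof (rule sum_mono)
      fix j assume j: "j \<in> N"
      have "0 \<le> r j" "0 \<le> x j $ i"
        using r j x portfoliosD(3) that by (auto simp: weights_def)
      then show "\<bar>r j * (z j $ i - x j $ i) + (r j - p j) * x j $ i\<bar>
          \<le> r j * \<bar>z j $ i - x j $ i\<bar> + \<bar>r j - p j\<bar> * x j $ i"
        using abs_triangle_ineq[of "r j * (z j $ i - x j $ i)" "(r j - p j) * x j $ i"]
        by (simp add: abs_mult)
    qed
    finally show ?thesis .
  qed
  then have "l1_norm_vec (mixture m N r z - mixture m N p x)
      \<le> (\<Sum>i<m. \<Sum>j\<in>N. r j * \<bar>z j $ i - x j $ i\<bar> + \<bar>r j - p j\<bar> * x j $ i)"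
    by (auto simp: l1_norm_vec_def mixture_def intro!: sum_mono)
  also have "\<dots> = (\<Sum>j\<in>N. \<Sum>i<m. r j * \<bar>z j $ i - x j $ i\<bar> + \<bar>r j - p j\<bar> * x j $ i)"
    by (rule sum.swap)
  also have "\<dots> = (\<Sum>j\<in>N. r j * l1_norm_vec (z j - x j) + \<bar>r j - p j\<bar>)"
  proof (rule sum.cong)
    fix j assume j: "j \<in> N"
    have "l1_norm_vec (z j - x j) = (\<Sum>i<m. \<bar>z j $ i - x j $ i\<bar>)"
      using portfoliosD(1)[OF x[OF j]] by (simp add: l1_norm_vec_def)
    then show "(\<Sum>i<m. r j * \<bar>z j $ i - x j $ i\<bar> + \<bar>r j - p j\<bar> * x j $ i)
        = r j * l1_norm_vec (z j - x j) + \<bar>r j - p j\<bar>"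
      using portfoliosD(4)[OF x[OF j]]
      by (simp add: sum.distrib sum_distrib_left[symmetric])
  qed simp
  finally show ?thesis
    by (simp add: sum.distrib l1_dist_on_def)
qed

section \<open>The regret bound\<close>

text \<open>
  All experts start from \<open>w0\<close>, so the prescribed \<open>w0\<close> at time \<open>0\<close> is also a mixture of
  the experts, for any weights that sum to one. Time \<open>1\<close> is therefore not a special case.
\<close>

lemma aggregate_eq_mixture:
  assumes setting: "tracking_setting m Y N a b l c y w0 w q T K" and "t \<le> T"
  shows "aggregate m N w0 w q t = mixture m N (q t) (\<lambda>j. w j t)"
proof (cases "t = 0")
  case True
  have "q 0 \<in> weights N"
    using setting by (auto simp: tracking_setting_def)
  then have "(\<Sum>j\<in>N. q 0 j) = 1"
    by (simp add: weights_def)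
  moreover have "(\<Sum>j\<in>N. q 0 j * w j 0 $ i) = (\<Sum>j\<in>N. q 0 j) * w0 $ i" for i
    using setting by (simp add: tracking_setting_def sum_distrib_right)
  moreover have "dim_vec w0 = m"
    using setting by (auto simp: tracking_setting_def portfoliosD(1))
  ultimately show ?thesis
    using True by (intro eq_vecI) (auto simp: aggregate_def mixture_def)
next
  case False
  then show ?thesis by (simp add: aggregate_def mixture_def)
qed

lemma cost_loss_aggregate_le:
  assumes setting: "tracking_setting m Y N a b l c y w0 w q T K" and t: "t \<in> {1..T}"
  shows "cost_loss l c y (aggregate m N w0 w q) t
    \<le> (\<Sum>j\<in>N. q t j * cost_loss l c y (w j) t) + c t * l1_dist_on N (q t) (q (t - 1))"
proof -
  have q: "q t \<in> weights N" and fin: "finite N" and c: "0 \<le> c t"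
    and conv: "convex_on_portfolios m (\<lambda>v. l v (y t))"
    using setting t by (auto simp: tracking_setting_def loss_function_def)
  have w: "w j s \<in> portfolios m" if "j \<in> N" "s \<le> T" for j s
    using setting that by (auto simp: tracking_setting_def)
  have prev: "t - 1 \<le> T"
    using t by auto
  have agg: "aggregate m N w0 w q s = mixture m N (q s) (\<lambda>j. w j s)" if "s \<le> T" for s
    using aggregate_eq_mixture[OF setting that] .
  have "l (aggregate m N w0 w q t) (y t) \<le> (\<Sum>j\<in>N. q t j * l (w j t) (y t))"
    using mixture_jensen[OF conv fin q, of "\<lambda>j. w j t"] w t by (simp add: agg)
  moreover have "l1_norm_vec (aggregate m N w0 w q t - aggregate m N w0 w q (t - 1))
      \<le> (\<Sum>j\<in>N. q t j * l1_norm_vec (w j t - w j (t - 1))) + l1_dist_on N (q t) (q (t - 1))"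
    using l1_norm_mixture_diff_le[OF q, of "\<lambda>j. w j (t - 1)" m "\<lambda>j. w j t" "q (t - 1)"]
      w agg[of t] agg[OF prev] t prev
    by simp
  then have "c t * l1_norm_vec (aggregate m N w0 w q t - aggregate m N w0 w q (t - 1))
      \<le> c t * ((\<Sum>j\<in>N. q t j * l1_norm_vec (w j t - w j (t - 1)))
               + l1_dist_on N (q t) (q (t - 1)))"
    using c by (rule mult_left_mono)
  ultimately have "cost_loss l c y (aggregate m N w0 w q) t
      \<le> (\<Sum>j\<in>N. q t j * l (w j t) (y t))
        + c t * ((\<Sum>j\<in>N. q t j * l1_norm_vec (w j t - w j (t - 1)))
               + l1_dist_on N (q t) (q (t - 1)))"
    unfolding cost_loss_def by linarith
  also have "\<dots> = (\<Sum>j\<in>N. q t j * cost_loss l c y (w j) t)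
      + c t * l1_dist_on N (q t) (q (t - 1))"
    by (simp add: cost_loss_def sum.distrib sum_distrib_left algebra_simps)
  finally show ?thesis .
qed

theorem tracking_regret_le:
  assumes setting: "tracking_setting m Y N a b l c y w0 w q T K"
    and min: "minimizing_benchmark N l c y w T K js"
  shows "tracking_regret m N l c y w0 w q T K
    \<le> (\<Sum>t=1..T. (\<Sum>j\<in>N. q t j * cost_loss l c y (w j) t) - cost_loss l c y (w (js t)) t)
      + (\<Sum>t=1..T. c t * l1_dist_on N (q t) (q (t - 1)))"
proof -
  have "(\<Sum>t=1..T. cost_loss l c y (aggregate m N w0 w q) t)
      \<le> (\<Sum>t=1..T. (\<Sum>j\<in>N. q t j * cost_loss l c y (w j) t)
          + c t * l1_dist_on N (q t) (q (t - 1)))"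
    by (intro sum_mono cost_loss_aggregate_le[OF setting])
  moreover have "min_benchmark_loss N l c y w T K = (\<Sum>t=1..T. cost_loss l c y (w (js t)) t)"
    using min by (simp add: minimizing_benchmark_def seq_loss_def)
  ultimately show ?thesis
    by (simp add: tracking_regret_def sum.distrib sum_subtractf)
qed

section \<open>Sharpness\<close>

lemma sum_nat_1_2: "(\<Sum>t=Suc 0..2. f t) = f 1 + f 2" for f :: "nat \<Rightarrow> real"
  by (simp add: numeral_2_eq_2)

lemma unit_vec_in_portfolios:
  assumes "k < m"
  shows "unit_vec m k \<in> portfolios m"
  using assms by (auto simp: portfolios_def unit_vec_def)

text \<open>
  The experts can reach different portfolios only by moving away from the common \<open>w0\<close>; making
  the first step free of charge keeps this movement out of the bill. In the second step the
  experts rest and all the weight passes from expert \<open>0\<close> to expert \<open>1\<close>.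
\<close>

lemma regret_bound_attained:
  fixes \<kappa> :: real
  assumes "\<kappa> < 1"
  defines "N \<equiv> {0, 1::nat}" and "l \<equiv> \<lambda>(_::real vec) (_::real vec). 0::real"
    and "c \<equiv> \<lambda>t::nat. if t = 2 then 1 else 0::real"
    and "y \<equiv> \<lambda>_::nat. 0\<^sub>v 2 :: real vec"
    and "w \<equiv> \<lambda>(j::nat) (t::nat). if t = 0 then unit_vec 2 0 else unit_vec 2 j :: real vec"
    and "q \<equiv> \<lambda>(t::nat) (j::nat). if (t = 2) = (j = 1) then 1 else 0 :: real"
    and "js \<equiv> restrict (\<lambda>_. 0::nat) {1..2::nat}"
  shows "tracking_setting 2 {0\<^sub>v 2} N 0 1 l c y (unit_vec 2 0) w q 2 0"
    and "minimizing_benchmark N l c y w 2 0 js"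
    and "tracking_regret 2 N l c y (unit_vec 2 0) w q 2 0
      > (\<Sum>t=1..2. (\<Sum>j\<in>N. q t j * cost_loss l c y (w j) t) - cost_loss l c y (w (js t)) t)
        + \<kappa> * (\<Sum>t=1..2. c t * l1_dist_on N (q t) (q (t - 1)))"
proof -
  show "tracking_setting 2 {0\<^sub>v 2} N 0 1 l c y (unit_vec 2 0) w q 2 0"
    by (auto simp: tracking_setting_def loss_function_def convex_on_portfolios_def weights_def
        N_def l_def c_def y_def w_def q_def unit_vec_in_portfolios)
  have free: "cost_loss l c y (w j) t = 0" if "t \<in> {1..2}" for j t
  proof (cases "t = 2")
    case True
    then show ?thesis by (simp add: cost_loss_def l_def w_def l1_norm_vec_def)
  next
    case False
    then show ?thesis by (simp add: cost_loss_def l_def c_def)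
  qed
  then have seq_free: "seq_loss l c y w 2 i = 0" for i
    by (simp add: seq_loss_def)
  have js: "js \<in> benchmark_seqs N 2 0"
    by (auto simp: benchmark_seqs_def switches_def js_def N_def)
  then have "seq_loss l c y w 2 ` benchmark_seqs N 2 0 = {0}"
    by (auto simp: seq_free)
  then have min_zero: "min_benchmark_loss N l c y w 2 0 = 0"
    by (simp add: min_benchmark_loss_def)
  show "minimizing_benchmark N l c y w 2 0 js"
    by (simp add: minimizing_benchmark_def js seq_free min_zero)
  have agg: "aggregate 2 N (unit_vec 2 0) w q 1 = unit_vec 2 0"
    "aggregate 2 N (unit_vec 2 0) w q 2 = unit_vec 2 1"
    by (auto simp: aggregate_def N_def q_def w_def intro!: eq_vecI)
  have "l1_norm_vec (unit_vec 2 1 - unit_vec 2 0) = 2"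
    by (simp add: l1_norm_vec_def numeral_2_eq_2)
  then have "(\<Sum>t=1..2. cost_loss l c y (aggregate 2 N (unit_vec 2 0) w q) t) = 2"
    using agg by (simp add: sum_nat_1_2 cost_loss_def l_def c_def)
  then have "tracking_regret 2 N l c y (unit_vec 2 0) w q 2 0 = 2"
    by (simp add: tracking_regret_def min_zero)
  moreover have "(\<Sum>t=1..2. c t * l1_dist_on N (q t) (q (t - 1))) = 2"
    by (simp add: sum_nat_1_2 c_def l1_dist_on_def N_def q_def)
  moreover have "(\<Sum>t=1..2. (\<Sum>j\<in>N. q t j * cost_loss l c y (w j) t)
      - cost_loss l c y (w (js t)) t) = 0"
    by (rule sum.neutral) (simp add: free)
  ultimately show "tracking_regret 2 N l c y (unit_vec 2 0) w q 2 0
      > (\<Sum>t=1..2. (\<Sum>j\<in>N. q t j * cost_loss l c y (w j) t) - cost_loss l c y (w (js t)) t)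
        + \<kappa> * (\<Sum>t=1..2. c t * l1_dist_on N (q t) (q (t - 1)))"
    using \<open>\<kappa> < 1\<close> by simp
qed

theorem theorem3p1:
  "(\<forall>(m::nat) (Y::real vec set) (N::'e set) (a::real) (b::real)
      (l::real vec \<Rightarrow> real vec \<Rightarrow> real) (c::nat \<Rightarrow> real) (y::nat \<Rightarrow> real vec) (w0::real vec)
      (w::'e \<Rightarrow> nat \<Rightarrow> real vec) (q::nat \<Rightarrow> 'e \<Rightarrow> real) (T::nat) (K::nat) (js::nat \<Rightarrow> 'e).
      tracking_setting m Y N a b l c y w0 w q T K \<longrightarrow>
      minimizing_benchmark N l c y w T K js \<longrightarrow>
      tracking_regret m N l c y w0 w q T K
        \<le> (\<Sum>t=1..T. (\<Sum>j\<in>N. q t j * cost_loss l c y (w j) t) - cost_loss l c y (w (js t)) t)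
          + (\<Sum>t=1..T. c t * l1_dist_on N (q t) (q (t - 1))))
   \<and>
   (\<forall>\<kappa>::real. \<kappa> < 1 \<longrightarrow>
     (\<exists>(m::nat) (Y::real vec set) (N::nat set) (a::real) (b::real)
      (l::real vec \<Rightarrow> real vec \<Rightarrow> real) (c::nat \<Rightarrow> real) (y::nat \<Rightarrow> real vec) (w0::real vec)
      (w::nat \<Rightarrow> nat \<Rightarrow> real vec) (q::nat \<Rightarrow> nat \<Rightarrow> real) (T::nat) (K::nat) (js::nat \<Rightarrow> nat).
      tracking_setting m Y N a b l c y w0 w q T K \<and>
      minimizing_benchmark N l c y w T K js \<and>
      tracking_regret m N l c y w0 w q T K
        > (\<Sum>t=1..T. (\<Sum>j\<in>N. q t j * cost_loss l c y (w j) t) - cost_loss l c y (w (js t)) t)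
          + \<kappa> * (\<Sum>t=1..T. c t * l1_dist_on N (q t) (q (t - 1)))))"
proof (intro conjI allI impI, goal_cases)
  case 1
  then show ?case by (rule tracking_regret_le)
next
  case (2 \<kappa>)
  show ?case
    by (intro exI conjI) (rule regret_bound_attained[OF \<open>\<kappa> < 1\<close>])+
qed

end
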